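(* Let $t$ be any binary tree pattern with $k\ge 2$ leaves. Then for every $n\ge 1$, $$\mathrm{av}_t(n) = s_{\{231,\,(k-1)(k-2)\cdots 21\}}(n-1).$$
   Context: All trees are full binary trees: rooted, ordered (plane) trees in which every vertex has either $0$ children (a leaf) or exactly $2$ ordered children (left and right). A tree $T$ contains a pattern $t$ (non-contiguously) if there is a tree $T^*$ obtained from $T$ by a finite sequence of edge contractions such that $t$ is a contiguous, rooted, ordered subtree of $T^*$; concretely, there is an injective map $\varphi$ from the vertices of $t$ to those of $T$ such that for every internal vertex $u$ of $t$ with left child $u_1$ and right child $u_2$, $\varphi(u_1)$ lies in the subtree rooted at the left child of $\varphi(u)$ and $\varphi(u_2)$ lies in the subtree rooted at the right child of $\varphi(u)$. Otherwise $T$ avoids $t$. $\mathrm{av}_t(n)$ is the number of binary trees with $n$ leaves avoiding $t$. For permutations $\pi=\pi_1\cdots\pi_n\in S(n)$ and $\rho\in S(m)$, $\pi$ contains $\rho$ if there are indices $i_1<\cdots<i_m$ with $\pi_{i_a}<\pi_{i_b}$ iff $\rho_a<\rho_b$; otherwise $\pi$ avoids $\rho$. For a set $Q$ of permutations, $s_Q(n)$ is the number of permutations in $S(n)$ avoiding every pattern in $Q$ ($S(0)$ consists of the empty permutation). Here $(k-1)(k-2)\cdots 21$ denotes the decreasing permutation of length $k-1$. *)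

theory Defs
  imports "HOL-Combinatorics.Multiset_Permutations" "HOL-Library.Sublist"
begin

datatype btree = Leaf | Node btree btree

fun num_leaves :: "btree \<Rightarrow> nat" where
  "num_leaves Leaf = 1"
| "num_leaves (Node l r) = num_leaves l + num_leaves r"

text \<open>A vertex (leaf or internal) is represented by the path leading to it from the root, so
  the children of an internal vertex \<open>u\<close> are \<open>u @ [Left]\<close> and \<open>u @ [Right]\<close>, and the descendants
  of \<open>u\<close> are the vertices having \<open>u\<close> as a prefix.\<close>

datatype dir = Left | Right

fun verts :: "btree \<Rightarrow> dir list set" where
  "verts Leaf = {[]}"
| "verts (Node l r) = {[]} \<union> (#) Left ` verts l \<union> (#) Right ` verts r"

definition internal_verts :: "btree \<Rightarrow> dir list set" where
  "internal_verts T = {u \<in> verts T. u @ [Left] \<in> verts T \<and> u @ [Right] \<in> verts T}"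

definition subtree_verts :: "btree \<Rightarrow> dir list \<Rightarrow> dir list set" where
  "subtree_verts T v = {w \<in> verts T. prefix v w}"

definition tree_contains :: "btree \<Rightarrow> btree \<Rightarrow> bool" where
  "tree_contains T t \<longleftrightarrow>
     (\<exists>\<phi>. inj_on \<phi> (verts t) \<and> \<phi> ` verts t \<subseteq> verts T \<and>
       (\<forall>u \<in> internal_verts t.
          \<phi> (u @ [Left]) \<in> subtree_verts T (\<phi> u @ [Left]) \<and>
          \<phi> (u @ [Right]) \<in> subtree_verts T (\<phi> u @ [Right])))"

definition av :: "btree \<Rightarrow> nat \<Rightarrow> nat" where
  "av t n = card {T. num_leaves T = n \<and> \<not> tree_contains T t}"

lemma num_leaves_pos: "num_leaves T > 0"
  by (induction T) auto

lemma finite_num_leaves: "finite {T. num_leaves T = n}"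
proof (induction n rule: less_induct)
  case (less n)
  let ?A = "\<Union>i<n. {T. num_leaves T = i}"
  have "{T. num_leaves T = n} \<subseteq> insert Leaf (case_prod Node ` (?A \<times> ?A))"
  proof
    fix T assume "T \<in> {T. num_leaves T = n}"
    then show "T \<in> insert Leaf (case_prod Node ` (?A \<times> ?A))"
      using num_leaves_pos by (cases T) force+
  qed
  moreover have "finite ?A"
    using less by blast
  ultimately show ?case
    by (meson finite.insertI finite_SigmaI finite_imageI finite_subset)
qed

text \<open>Permutations of \<open>{1..n}\<close> are lists in one-line notation, indexed from 0.\<close>

definition perm_contains :: "nat list \<Rightarrow> nat list \<Rightarrow> bool" where
  "perm_contains \<pi> \<rho> \<longleftrightarrow>
     (\<exists>i. strict_mono_on {..<length \<rho>} i \<and> i ` {..<length \<rho>} \<subseteq> {..<length \<pi>} \<and>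
       (\<forall>a < length \<rho>. \<forall>b < length \<rho>. \<pi> ! i a < \<pi> ! i b \<longleftrightarrow> \<rho> ! a < \<rho> ! b))"

definition num_avoiding_perms :: "nat list set \<Rightarrow> nat \<Rightarrow> nat" where
  "num_avoiding_perms Q n =
     card {\<pi> \<in> permutations_of_set {1..n}. \<forall>\<rho>\<in>Q. \<not> perm_contains \<pi> \<rho>}"

end

theory Submission
  imports Defs "HOL-Computational_Algebra.Formal_Power_Series"
begin

text \<open>For a pattern with left and right subtrees \<open>a\<close> and \<open>b\<close>, splitting a tree at its root shows
  that the generating functions \<open>A\<close> of avoiding trees satisfy
  \<open>A\<^sub>t (1 - A\<^sub>a - A\<^sub>b) = X - A\<^sub>a A\<^sub>b\<close>. The operation \<open>(p, q) \<mapsto> (X - p q) / (1 - p - q)\<close> is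
  associative, so \<open>A\<^sub>t\<close> depends only on the number of leaves of \<open>t\<close>, and \<open>t\<close> may be taken to be a
  right comb. A \<open>231\<close>-avoiding permutation has the form \<open>L m R\<close> with maximum \<open>m\<close> and every entry
  of \<open>L\<close> below every entry of \<open>R\<close>; reading \<open>L\<close> and \<open>R\<close> as left and right subtrees gives a bijection
  with trees. A decreasing subsequence lies within \<open>L\<close> or within \<open>m R\<close>, so the decreasing pattern
  corresponds to the right comb.\<close>

section \<open>Containment of trees\<close>

text \<open>Recursion on where the root of the pattern goes: into the left subtree, into the right
  subtree, or onto the root, in which case the two subpatterns must go to the respective
  sides.\<close>

fun emb :: "btree \<Rightarrow> btree \<Rightarrow> bool" where
  "emb T Leaf = True"
| "emb Leaf (Node a b) = False"
| "emb (Node l r) (Node a b) =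
     (emb l (Node a b) \<or> emb r (Node a b) \<or> (emb l a \<and> emb r b))"

text \<open>The condition on a witness of \<open>tree_contains\<close>, named so that witnesses can
  be restricted, shifted and glued.\<close>

definition tree_embedding :: "btree \<Rightarrow> btree \<Rightarrow> (dir list \<Rightarrow> dir list) \<Rightarrow> bool" where
  "tree_embedding T t \<phi> \<longleftrightarrow> inj_on \<phi> (verts t) \<and> \<phi> ` verts t \<subseteq> verts T \<and>
       (\<forall>u \<in> internal_verts t.
          \<phi> (u @ [Left]) \<in> subtree_verts T (\<phi> u @ [Left]) \<and>
          \<phi> (u @ [Right]) \<in> subtree_verts T (\<phi> u @ [Right]))"

lemma tree_contains_iff_embedding: "tree_contains T t \<longleftrightarrow> (\<exists>\<phi>. tree_embedding T t \<phi>)"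
  by (simp add: tree_contains_def tree_embedding_def)

section \<open>Vertices as paths, and embeddings through the prefix order\<close>

lemma Nil_in_verts [simp]: "[] \<in> verts T"
  by (cases T) auto

text \<open>The \<open>case d of\<close> form treats both children at once; it takes over from
  \<open>verts.simps(2)\<close> as the rewrite rule.\<close>

lemma Cons_in_verts_Node [simp]:
  "d # w \<in> verts (Node l r) \<longleftrightarrow> w \<in> verts (case d of Left \<Rightarrow> l | Right \<Rightarrow> r)"
  by (cases d) auto

declare verts.simps(2) [simp del]

lemma verts_prefix_closed: "u @ w \<in> verts T \<Longrightarrow> u \<in> verts T"
proof (induction u arbitrary: T)
  case (Cons d u)
  then show ?case by (cases T) auto
qed auto

lemma verts_sibling: "u @ [d] \<in> verts T \<Longrightarrow> u @ [e] \<in> verts T"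
proof (induction u arbitrary: T)
  case Nil
  then show ?case by (cases T) (auto split: dir.splits)
next
  case (Cons c u)
  then show ?case by (cases T) auto
qed

text \<open>The trees are full: a vertex with one child has both, so any single direction
  \<open>d\<close> detects internality.\<close>

lemma internal_verts_iff: "u \<in> internal_verts T \<longleftrightarrow> u @ [d] \<in> verts T"
  unfolding internal_verts_def using verts_sibling verts_prefix_closed by blast

lemma internal_verts_Leaf [simp]: "internal_verts Leaf = {}"
  by (simp add: internal_verts_def)

lemma Nil_internal_Node [simp]: "[] \<in> internal_verts (Node l r)"
  by (simp add: internal_verts_def)

lemma Cons_internal_Node [simp]:
  "d # w \<in> internal_verts (Node l r) \<longleftrightarrow> w \<in> internal_verts (case d of Left \<Rightarrow> l | Right \<Rightarrow> r)"
  by (simp add: internal_verts_def)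

text \<open>Children of internal vertices are themselves vertices of \<open>t\<close>, so membership
  of their images in \<open>T\<close> is part of the second conjunct and the child condition reduces
  to a prefix condition.\<close>

lemma tree_embedding_iff:
  "tree_embedding T t \<phi> \<longleftrightarrow> inj_on \<phi> (verts t) \<and> (\<forall>u \<in> verts t. \<phi> u \<in> verts T) \<and>
     (\<forall>u d. u \<in> internal_verts t \<longrightarrow> prefix (\<phi> u @ [d]) (\<phi> (u @ [d])))"
proof -
  have all_dir: "(\<forall>d. P d) \<longleftrightarrow> P Left \<and> P Right" for P :: "dir \<Rightarrow> bool"
    using dir.induct by blast
  have "u @ [d] \<in> verts t" if "u \<in> internal_verts t" for u d
    using that internal_verts_iff by blast
  then show ?thesis
    unfolding tree_embedding_def subtree_verts_def all_dir image_subset_iff mem_Collect_eq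
    by blast
qed

text \<open>Along a path from the root, every edge of the pattern extends the image path.\<close>

lemma tree_embedding_root_prefix:
  assumes "tree_embedding T t \<phi>" "u \<in> verts t"
  shows "prefix (\<phi> []) (\<phi> u)"
  using assms(2)
proof (induction u rule: rev_induct)
  case (snoc d u)
  then have "u \<in> verts t" "u \<in> internal_verts t"
    using verts_prefix_closed internal_verts_iff by blast+
  then show ?case
    using assms(1) snoc.IH unfolding tree_embedding_iff
    by (meson append_prefixD prefix_order.trans)
qed simp

lemma tree_embedding_subpattern:
  assumes "tree_embedding T (Node a b) \<phi>"
  shows "tree_embedding T (case d of Left \<Rightarrow> a | Right \<Rightarrow> b) (\<lambda>w. \<phi> (d # w))"
proof -
  have "inj_on (\<lambda>w. \<phi> (d # w)) (verts (case d of Left \<Rightarrow> a | Right \<Rightarrow> b))"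
    using assms unfolding tree_embedding_iff inj_on_def
    by (metis Cons_in_verts_Node list.inject)
  moreover have "prefix (\<phi> (d # u) @ [e]) (\<phi> (d # u @ [e]))"
    if "u \<in> internal_verts (case d of Left \<Rightarrow> a | Right \<Rightarrow> b)" for u e
    using assms that unfolding tree_embedding_iff
    by (metis Cons_internal_Node append_Cons)
  ultimately show ?thesis
    using assms unfolding tree_embedding_iff by simp
qed

text \<open>Once the root maps strictly below the root of the host, every image starts with the same
  direction \<open>d\<close>, which \<open>tl\<close> strips off.\<close>

lemma tree_embedding_subtree:
  assumes "tree_embedding (Node l r) t \<phi>" "prefix [d] (\<phi> [])"
  shows "tree_embedding (case d of Left \<Rightarrow> l | Right \<Rightarrow> r) t (\<lambda>w. tl (\<phi> w))"
proof -
  have *: "\<phi> u = d # tl (\<phi> u)" if "u \<in> verts t" for u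
    using tree_embedding_root_prefix[OF assms(1) that] assms(2)
    by (auto simp: prefix_def)
  have "inj_on (\<lambda>w. tl (\<phi> w)) (verts t)"
    using assms(1) * unfolding tree_embedding_iff inj_on_def by metis
  moreover have "tl (\<phi> u) \<in> verts (case d of Left \<Rightarrow> l | Right \<Rightarrow> r)" if "u \<in> verts t" for u
    using assms(1) *[OF that] that Cons_in_verts_Node unfolding tree_embedding_iff by metis
  moreover have "prefix (tl (\<phi> u) @ [e]) (tl (\<phi> (u @ [e])))" if "u \<in> internal_verts t" for u e
  proof -
    have "u \<in> verts t" "u @ [e] \<in> verts t"
      using that internal_verts_iff verts_prefix_closed by blast+
    moreover have "prefix (\<phi> u @ [e]) (\<phi> (u @ [e]))"
      using assms(1) that unfolding tree_embedding_iff by blast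
    ultimately show ?thesis
      using * by (metis append_Cons Cons_prefix_Cons)
  qed
  ultimately show ?thesis
    unfolding tree_embedding_iff by blast
qed

text \<open>The path \<open>\<phi> []\<close> selects the disjunct of \<open>emb\<close>: if empty,
  both subpatterns descend to their own sides; otherwise its first direction names the subtree
  holding the whole pattern.\<close>

lemma emb_if_tree_embedding: "tree_embedding T t \<phi> \<Longrightarrow> emb T t"
proof (induction T t arbitrary: \<phi> rule: emb.induct)
  case (2 a b)
  \<comment> \<open>The host is a leaf, whose only vertex cannot be the image of two vertices under
    an injective map.\<close>
  have "[] \<in> verts (Node a b)" "[Left] \<in> verts (Node a b)"
    by simp_all
  then have "\<phi> [] = \<phi> [Left]" "inj_on \<phi> (verts (Node a b))"
    using 2 unfolding tree_embedding_iff by simp_all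
  then show ?case by (simp add: inj_on_eq_iff)
next
  case (3 l r a b)
  show ?case
  proof (cases "\<phi> []")
    case Nil
    have "prefix [d] (\<phi> [d])" for d
      using "3.prems" Nil Nil_internal_Node unfolding tree_embedding_iff
      by (metis append_Nil)
    then have "tree_embedding (case d of Left \<Rightarrow> l | Right \<Rightarrow> r)
        (case d of Left \<Rightarrow> a | Right \<Rightarrow> b) (\<lambda>w. tl (\<phi> (d # w)))" for d
      using tree_embedding_subtree[OF tree_embedding_subpattern[OF "3.prems"]] by blast
    from this[of Left] this[of Right] show ?thesis
      using "3.IH" by auto
  next
    case (Cons d v)
    have "tree_embedding (case d of Left \<Rightarrow> l | Right \<Rightarrow> r) (Node a b) (\<lambda>w. tl (\<phi> w))"
      using tree_embedding_subtree[OF "3.prems"] Cons by simp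
    then show ?thesis
      using "3.IH" by (cases d) auto
  qed
qed simp

lemma tree_embedding_Cons:
  assumes "tree_embedding (case d of Left \<Rightarrow> l | Right \<Rightarrow> r) t \<phi>"
  shows "tree_embedding (Node l r) t (\<lambda>w. d # \<phi> w)"
  using assms unfolding tree_embedding_iff by (simp add: inj_on_def)

lemma tree_embedding_Node:
  assumes "tree_embedding l a \<phi>" "tree_embedding r b \<psi>"
  shows "tree_embedding (Node l r) (Node a b)
    (\<lambda>w. case w of [] \<Rightarrow> [] | Left # v \<Rightarrow> Left # \<phi> v | Right # v \<Rightarrow> Right # \<psi> v)"
  using assms unfolding tree_embedding_iff
  by (auto simp: inj_on_def split: list.splits dir.splits)

lemma tree_embedding_if_emb: "emb T t \<Longrightarrow> \<exists>\<phi>. tree_embedding T t \<phi>"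
proof (induction T t rule: emb.induct)
  case (1 T)
  have "tree_embedding T Leaf (\<lambda>_. [])"
    by (simp add: tree_embedding_iff)
  then show ?case by blast
next
  case (3 l r a b)
  then show ?case
    using tree_embedding_Node tree_embedding_Cons[where d = Left] tree_embedding_Cons[where d = Right]
    by (auto; blast)
qed simp

lemma tree_contains_iff_emb: "tree_contains T t \<longleftrightarrow> emb T t"
  using tree_contains_iff_embedding emb_if_tree_embedding tree_embedding_if_emb by blast

lemma emb_NodeI: "emb l t \<or> emb r t \<Longrightarrow> emb (Node l r) t"
  by (cases t) auto

text \<open>Makes avoidance monotone: avoiders of \<open>a\<close> or of \<open>b\<close> also avoid
  \<open>Node a b\<close>.\<close>

lemma emb_Node_pattern: "emb T (Node a b) \<Longrightarrow> emb T a \<and> emb T b"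
proof (induction T)
  case (Node l r)
  then show ?case using emb_NodeI by auto
qed simp

section \<open>Generating functions of avoiding trees\<close>

definition avoiding :: "btree \<Rightarrow> nat \<Rightarrow> btree set" where
  "avoiding t n = {T. num_leaves T = n \<and> \<not> emb T t}"

definition av_gf :: "btree \<Rightarrow> int fps" where
  "av_gf t = Abs_fps (\<lambda>n. int (card (avoiding t n)))"

lemma av_eq_card_avoiding: "av t n = card (avoiding t n)"
  by (simp add: av_def avoiding_def tree_contains_iff_emb)

lemma finite_avoiding [simp]: "finite (avoiding t n)"
  unfolding avoiding_def by (rule finite_subset[OF _ finite_num_leaves[of n]]) auto

lemma avoiding_0 [simp]: "avoiding t 0 = {}"
  using num_leaves_pos by (auto simp: avoiding_def)

section \<open>Decomposition of avoiding trees at the root\<close>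

lemma avoiding_subset_Node:
  "avoiding a n \<subseteq> avoiding (Node a b) n" "avoiding b n \<subseteq> avoiding (Node a b) n"
  by (auto simp: avoiding_def dest: emb_Node_pattern)

text \<open>The set consists of the pairs with first entry in \<open>A'\<close> or second entry in
  \<open>B'\<close>, counted by inclusion-exclusion; it will hold the admissible pairs of
  subtrees.\<close>

lemma card_Times_minus_Times:
  fixes A B A' B' :: "'a set"
  assumes "finite A" "finite B" "A' \<subseteq> A" "B' \<subseteq> B"
  shows "int (card (A \<times> B - (A - A') \<times> (B - B'))) =
    int (card A) * int (card B') + int (card A') * int (card B) - int (card A') * int (card B')"
proof -
  have fin: "finite A'" "finite B'"
    using assms finite_subset by blast+
  have eq: "A \<times> B - (A - A') \<times> (B - B') = A \<times> B' \<union> A' \<times> (B - B')"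
    using assms by blast
  have "card (A \<times> B - (A - A') \<times> (B - B')) = card A * card B' + card A' * card (B - B')"
    unfolding eq using assms fin by (subst card_Un_disjoint) (auto simp: card_cartesian_product)
  moreover have "int (card (B - B')) = int (card B) - int (card B')"
    using assms fin by (simp add: card_Diff_subset card_mono of_nat_diff)
  ultimately show ?thesis
    by (simp add: right_diff_distrib)
qed

text \<open>Both subtrees must avoid \<open>t\<close>, and the removed product consists of the pairs
  in which the left one contains \<open>a\<close> and the right one contains \<open>b\<close>, that
  is, where \<open>t\<close> occurs at the root.\<close>

lemma avoiding_Node_eq:
  assumes "t = Node a b"
  shows "avoiding t n = (if n = 1 then {Leaf} else {}) \<union> (\<Union>i\<le>n. case_prod Node `
    (avoiding t i \<times> avoiding t (n - i) -
      (avoiding t i - avoiding a i) \<times> (avoiding t (n - i) - avoiding b (n - i))))"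
    (is "_ = ?R")
proof (intro set_eqI)
  fix T
  show "T \<in> avoiding t n \<longleftrightarrow> T \<in> ?R"
  proof (cases T)
    case Leaf
    then show ?thesis
      using assms by (auto simp: avoiding_def)
  next
    case (Node l r)
    have "T \<in> ?R \<longleftrightarrow> (\<exists>i\<le>n. l \<in> avoiding t i \<and> r \<in> avoiding t (n - i) \<and>
        (l \<in> avoiding a i \<or> r \<in> avoiding b (n - i)))"
      using Node by auto
    also have "\<dots> \<longleftrightarrow> num_leaves l + num_leaves r = n \<and> \<not> emb l t \<and> \<not> emb r t \<and>
        (\<not> emb l a \<or> \<not> emb r b)"
      by (auto simp: avoiding_def)
    also have "\<dots> \<longleftrightarrow> T \<in> avoiding t n"
      using Node assms by (auto simp: avoiding_def)
    finally show ?thesis by blast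
  qed
qed

lemma card_avoiding_Node:
  assumes "t = Node a b"
  shows "int (card (avoiding t n)) = (if n = 1 then 1 else 0) +
    (\<Sum>i\<le>n. int (card (avoiding t i)) * int (card (avoiding b (n - i)))
      + int (card (avoiding a i)) * int (card (avoiding t (n - i)))
      - int (card (avoiding a i)) * int (card (avoiding b (n - i))))"
proof -
  define S where "S i = avoiding t i \<times> avoiding t (n - i) -
    (avoiding t i - avoiding a i) \<times> (avoiding t (n - i) - avoiding b (n - i))" for i
  have split: "avoiding t n = (if n = 1 then {Leaf} else {}) \<union> (\<Union>i\<le>n. case_prod Node ` S i)"
    unfolding S_def by (rule avoiding_Node_eq[OF assms])
  have finS: "finite (S i)" for i
    by (simp add: S_def)
  have injN: "inj_on (case_prod Node) X" for X
    by (auto simp: inj_on_def)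
  \<comment> \<open>The index is recovered from a tree as the number of leaves of its left
    subtree.\<close>
  have disj: "case_prod Node ` S i \<inter> case_prod Node ` S j = {}" if "i \<noteq> j" for i j
    using that by (auto simp: S_def avoiding_def)
  have "card (avoiding t n) =
      card (if n = 1 then {Leaf} else {}) + card (\<Union>i\<le>n. case_prod Node ` S i)"
    unfolding split using finS by (intro card_Un_disjoint) auto
  also have "card (\<Union>i\<le>n. case_prod Node ` S i) = (\<Sum>i\<le>n. card (case_prod Node ` S i))"
    using finS disj by (intro card_UN_disjoint) auto
  also have "\<dots> = (\<Sum>i\<le>n. card (S i))"
    by (simp add: card_image[OF injN])
  finally have "int (card (avoiding t n)) = (if n = 1 then 1 else 0) + (\<Sum>i\<le>n. int (card (S i)))"
    by simp
  then show ?thesis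
    unfolding S_def assms
    by (simp add: card_Times_minus_Times avoiding_subset_Node)
qed

text \<open>The three convolutions in \<open>card_avoiding_Node\<close> are Cauchy products, and the
  one-vertex tree contributes \<open>fps_X\<close>.\<close>

lemma av_gf_Node:
  "av_gf (Node a b) * (1 - av_gf a - av_gf b) = fps_X - av_gf a * av_gf b"
proof -
  have "av_gf (Node a b) = fps_X + av_gf (Node a b) * av_gf b
      + av_gf a * av_gf (Node a b) - av_gf a * av_gf b"
  proof (rule fps_ext)
    fix n
    show "fps_nth (av_gf (Node a b)) n = fps_nth (fps_X + av_gf (Node a b) * av_gf b
      + av_gf a * av_gf (Node a b) - av_gf a * av_gf b) n"
      by (simp add: av_gf_def fps_mult_nth fps_X_nth card_avoiding_Node[OF refl, of a b n]
          sum.distrib sum_subtractf atLeast0AtMost)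
  qed
  then show ?thesis
    by (simp add: algebra_simps)
qed

section \<open>Dependence on the number of leaves only\<close>

lemma av_gf_nth_0 [simp]: "fps_nth (av_gf t) 0 = 0"
  by (simp add: av_gf_def)

lemma fps_nonzero_if_nth_0: "fps_nth f 0 \<noteq> 0 \<Longrightarrow> f \<noteq> 0"
  by auto

text \<open>The factor \<open>1 - av_gf a - av_gf b\<close> has constant coefficient 1, so it can be
  cancelled and the functional equation determines \<open>av_gf (Node a b)\<close>.\<close>

lemma av_gf_Node_cong:
  assumes "av_gf a = av_gf a'" "av_gf b = av_gf b'"
  shows "av_gf (Node a b) = av_gf (Node a' b')"
proof -
  have "1 - av_gf a - av_gf b \<noteq> 0"
    by (rule fps_nonzero_if_nth_0) simp
  then show ?thesis
    using av_gf_Node[of a b] av_gf_Node[of a' b'] assms by (metis mult_right_cancel)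
qed

text \<open>Eliminating \<open>U\<close> and \<open>V\<close> turns both equations into the same
  one, with coefficient \<open>D\<close> and right-hand side symmetric in \<open>P\<close>,
  \<open>Q\<close>, \<open>R\<close>.\<close>

lemma av_gf_assoc: "av_gf (Node (Node a b) c) = av_gf (Node a (Node b c))"
proof -
  define P Q R where "P = av_gf a" and "Q = av_gf b" and "R = av_gf c"
  define U V where "U = av_gf (Node a b)" and "V = av_gf (Node b c)"
  \<comment> \<open>This is \<open>(1 - U - R) * (1 - P - Q)\<close> with \<open>U\<close>
    eliminated, and equally \<open>(1 - P - V) * (1 - Q - R)\<close> with \<open>V\<close>
    eliminated.\<close>
  define D where "D = 1 - P - Q - R + P * Q + P * R + Q * R - fps_X"
  have UV: "U * (1 - P - Q) = fps_X - P * Q" "V * (1 - Q - R) = fps_X - Q * R"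
    unfolding U_def V_def P_def Q_def R_def by (rule av_gf_Node)+
  have L: "av_gf (Node (Node a b) c) * (1 - U - R) = fps_X - U * R"
    and M: "av_gf (Node a (Node b c)) * (1 - P - V) = fps_X - P * V"
    unfolding U_def V_def P_def Q_def R_def by (rule av_gf_Node)+
  have "av_gf (Node (Node a b) c) * D = fps_X * (1 - P - Q - R) + P * Q * R"
    using UV(1) L unfolding D_def by algebra
  moreover have "av_gf (Node a (Node b c)) * D = fps_X * (1 - P - Q - R) + P * Q * R"
    using UV(2) M unfolding D_def by algebra
  moreover have "D \<noteq> 0"
    by (rule fps_nonzero_if_nth_0) (simp add: D_def P_def Q_def R_def)
  ultimately show ?thesis
    by (metis mult_right_cancel)
qed

text \<open>The argument counts internal vertices, so \<open>right_comb m\<close> has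
  \<open>m + 1\<close> leaves.\<close>

fun right_comb :: "nat \<Rightarrow> btree" where
  "right_comb 0 = Leaf"
| "right_comb (Suc m) = Node Leaf (right_comb m)"

text \<open>Associativity moves the leaves of the left comb to the front one at a time.\<close>

lemma av_gf_Node_right_comb:
  "av_gf (Node (right_comb i) (right_comb j)) = av_gf (right_comb (Suc (i + j)))"
proof (induction i)
  case (Suc i)
  then show ?case
    using av_gf_assoc[of Leaf "right_comb i" "right_comb j"] av_gf_Node_cong[OF refl Suc.IH]
    by simp
qed simp

lemma av_gf_eq_right_comb: "av_gf t = av_gf (right_comb (num_leaves t - 1))"
proof (induction t)
  case (Node a b)
  \<comment> \<open>Internal vertices add up over the two subtrees, plus one for the root.\<close>
  have "Suc ((num_leaves a - 1) + (num_leaves b - 1)) = num_leaves (Node a b) - 1"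
    using num_leaves_pos[of a] num_leaves_pos[of b] by simp
  then show ?case
    using av_gf_Node_cong[OF Node.IH] av_gf_Node_right_comb by metis
qed simp

lemma av_eq_right_comb: "av t n = av (right_comb (num_leaves t - 1)) n"
proof -
  have "int (av s n) = fps_nth (av_gf s) n" for s
    by (simp add: av_gf_def av_eq_card_avoiding)
  then show ?thesis
    using av_gf_eq_right_comb[of t] by (metis of_nat_eq_iff)
qed

section \<open>Pattern containment through subsequences\<close>

lemma subseq_iff_indices:
  "subseq ys xs \<longleftrightarrow> (\<exists>i. strict_mono_on {..<length ys} i \<and> i ` {..<length ys} \<subseteq> {..<length xs} \<and>
     (\<forall>a<length ys. xs ! i a = ys ! a))" (is "?L \<longleftrightarrow> ?R")
proof
  assume ?L
  then show ?R
  proof (induction rule: list_emb.induct)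
    case (list_emb_Nil ys)
    then show ?case by (auto simp: strict_mono_on_def)
  next
    case (list_emb_Cons ys xs x)
    then obtain i where i: "strict_mono_on {..<length ys} i" "i ` {..<length ys} \<subseteq> {..<length xs}"
      "\<forall>a<length ys. xs ! i a = ys ! a" by blast
    then show ?case
      by (intro exI[of _ "\<lambda>a. Suc (i a)"]) (auto simp: strict_mono_on_def)
  next
    case (list_emb_Cons2 y x ys xs)
    then obtain i where i: "strict_mono_on {..<length ys} i" "i ` {..<length ys} \<subseteq> {..<length xs}"
      "\<forall>a<length ys. xs ! i a = ys ! a" by blast
    then have "\<And>a. a < length ys \<Longrightarrow> i a < length xs"
      by blast
    with i show ?case
      using list_emb_Cons2(1)
      \<comment> \<open>The matched heads sit at position 0; all later positions shift by
        one.\<close>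
      by (intro exI[of _ "\<lambda>a. case a of 0 \<Rightarrow> 0 | Suc b \<Rightarrow> Suc (i b)"])
        (auto simp: strict_mono_on_def less_Suc_eq_0_disj nth_Cons split: nat.splits)
  qed
next
  assume ?R
  then obtain i where i: "strict_mono_on {..<length ys} i" "i ` {..<length ys} \<subseteq> {..<length xs}"
    "\<forall>a<length ys. xs ! i a = ys ! a" by blast
  define js where "js = map i [0..<length ys]"
  have "sorted_wrt (<) js"
    using i(1) by (auto simp: sorted_wrt_iff_nth_less js_def strict_mono_on_def)
  moreover have "set js \<subseteq> {..<length xs}"
    using i(2) by (simp add: js_def lessThan_atLeast0)
  \<comment> \<open>Both lists are strictly increasing with the same entries, and a filtered list is
    a subsequence.\<close>
  ultimately have "js = filter (\<lambda>j. j \<in> set js) [0..<length xs]"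
    by (intro strict_sorted_equal) (auto simp: sorted_wrt_filter)
  then have "subseq js [0..<length xs]"
    by (metis subseq_filter_left)
  then have "subseq (map ((!) xs) js) (map ((!) xs) [0..<length xs])"
    by (rule subseq_map)
  moreover have "map ((!) xs) js = ys"
    using i(3) by (intro nth_equalityI) (auto simp: js_def)
  ultimately show ?L
    by (simp add: map_nth)
qed

lemma perm_contains_iff_subseq:
  "perm_contains \<pi> \<rho> \<longleftrightarrow> (\<exists>ys. subseq ys \<pi> \<and> length ys = length \<rho> \<and>
     (\<forall>a<length \<rho>. \<forall>b<length \<rho>. ys ! a < ys ! b \<longleftrightarrow> \<rho> ! a < \<rho> ! b))" (is "?L \<longleftrightarrow> ?R")
proof
  assume ?L
  then obtain i where i: "strict_mono_on {..<length \<rho>} i" "i ` {..<length \<rho>} \<subseteq> {..<length \<pi>}"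
    "\<forall>a<length \<rho>. \<forall>b<length \<rho>. \<pi> ! i a < \<pi> ! i b \<longleftrightarrow> \<rho> ! a < \<rho> ! b"
    unfolding perm_contains_def by blast
  define ys where "ys = map (\<lambda>a. \<pi> ! i a) [0..<length \<rho>]"
  have "subseq ys \<pi>"
    unfolding subseq_iff_indices by (rule exI[of _ i]) (use i in \<open>simp add: ys_def\<close>)
  then show ?R
    using i(3) by (intro exI[of _ ys]) (simp add: ys_def)
next
  assume ?R
  then obtain ys where ys: "subseq ys \<pi>" "length ys = length \<rho>"
    "\<forall>a<length \<rho>. \<forall>b<length \<rho>. ys ! a < ys ! b \<longleftrightarrow> \<rho> ! a < \<rho> ! b" by blast
  then obtain i where "strict_mono_on {..<length ys} i" "i ` {..<length ys} \<subseteq> {..<length \<pi>}"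
    "\<forall>a<length ys. \<pi> ! i a = ys ! a"
    unfolding subseq_iff_indices by blast
  with ys show ?L
    unfolding perm_contains_def by (intro exI[of _ i]) simp
qed

definition contains_231 :: "nat list \<Rightarrow> bool" where
  "contains_231 xs \<longleftrightarrow> (\<exists>x y z. subseq [x, y, z] xs \<and> z < x \<and> x < y)"

definition has_decreasing :: "nat \<Rightarrow> nat list \<Rightarrow> bool" where
  "has_decreasing m xs \<longleftrightarrow> (\<exists>ys. subseq ys xs \<and> length ys = m \<and> sorted_wrt (>) ys)"

lemma perm_contains_231_iff: "perm_contains \<pi> [2, 3, 1] \<longleftrightarrow> contains_231 \<pi>"
proof -
  have all3: "(\<forall>a<Suc (Suc (Suc 0)). P a) \<longleftrightarrow> P 0 \<and> P 1 \<and> P 2" for P :: "nat \<Rightarrow> bool"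
    by (auto simp: less_Suc_eq numeral_2_eq_2)
  have ex3: "(\<exists>ys. length ys = Suc (Suc (Suc 0)) \<and> P ys) \<longleftrightarrow> (\<exists>x y z. P [x, y, z])"
    for P :: "nat list \<Rightarrow> bool"
    by (auto simp: length_Suc_conv) blast
  have "perm_contains \<pi> [2, 3, 1] \<longleftrightarrow>
      (\<exists>ys. length ys = Suc (Suc (Suc 0)) \<and> subseq ys \<pi> \<and>
        (\<forall>a<Suc (Suc (Suc 0)). \<forall>b<Suc (Suc (Suc 0)).
          ys ! a < ys ! b \<longleftrightarrow> [2, 3, 1::nat] ! a < [2, 3, 1] ! b))"
    unfolding perm_contains_iff_subseq by (auto simp only: list.size add_0 add_Suc_right add_0_right)
  also have "\<dots> \<longleftrightarrow> contains_231 \<pi>"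
    unfolding contains_231_def ex3 all3 by (auto 4 4)
  finally show ?thesis .
qed

text \<open>The entry of \<open>rev [1..<k]\<close> at position \<open>a\<close> is
  \<open>k - 1 - a\<close>, so comparing entries reverses comparing positions.\<close>

lemma perm_contains_decreasing_iff:
  "perm_contains \<pi> (rev [1..<k]) \<longleftrightarrow> has_decreasing (k - 1) \<pi>"
proof -
  have "(\<forall>a<k - 1. \<forall>b<k - 1. ys ! a < ys ! b \<longleftrightarrow> rev [1..<k] ! a < rev [1..<k] ! b) \<longleftrightarrow>
      sorted_wrt (>) ys" if len: "length ys = k - 1" for ys :: "nat list"
  proof -
    have "rev [1..<k] ! a < rev [1..<k] ! b \<longleftrightarrow> b < a" if "a < k - 1" "b < k - 1" for a b
      using that by (auto simp: rev_nth)
    then have "(\<forall>a<k - 1. \<forall>b<k - 1. ys ! a < ys ! b \<longleftrightarrow> rev [1..<k] ! a < rev [1..<k] ! b) \<longleftrightarrow>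
        (\<forall>a<k - 1. \<forall>b<k - 1. ys ! a < ys ! b \<longleftrightarrow> b < a)"
      by simp
    also have "\<dots> \<longleftrightarrow> sorted_wrt (>) ys"
    proof
      assume "\<forall>a<k - 1. \<forall>b<k - 1. ys ! a < ys ! b \<longleftrightarrow> b < a"
      then show "sorted_wrt (>) ys"
        by (simp add: sorted_wrt_iff_nth_less len)
    next
      assume dec: "sorted_wrt (>) ys"
      show "\<forall>a<k - 1. \<forall>b<k - 1. ys ! a < ys ! b \<longleftrightarrow> b < a"
      proof (intro allI impI)
        fix a b assume "a < k - 1" "b < k - 1"
        then show "ys ! a < ys ! b \<longleftrightarrow> b < a"
          using sorted_wrt_nth_less[OF dec, of a b] sorted_wrt_nth_less[OF dec, of b a] len
          by (cases a b rule: linorder_cases) auto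
      qed
    qed
    finally show ?thesis .
  qed
  then show ?thesis
    unfolding perm_contains_iff_subseq has_decreasing_def by auto
qed

section \<open>Trees and 231-avoiding permutations\<close>

text \<open>The entries fill an interval starting at \<open>s\<close>, one for each internal vertex.
  The left subtree gets the lowest values, the right subtree the next ones, and the root the
  maximum.\<close>

fun tree_perm :: "nat \<Rightarrow> btree \<Rightarrow> nat list" where
  "tree_perm s Leaf = []"
| "tree_perm s (Node l r) =
     tree_perm s l @ (s + num_leaves l + num_leaves r - 2) # tree_perm (s + num_leaves l - 1) r"

lemma set_tree_perm: "set (tree_perm s T) = {s..<s + num_leaves T - 1}"
proof (induction T arbitrary: s)
  case (Node l r)
  then show ?case
    using num_leaves_pos[of l] num_leaves_pos[of r] by auto
qed simp

lemma length_tree_perm: "length (tree_perm s T) = num_leaves T - 1"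
proof (induction T arbitrary: s)
  case (Node l r)
  then show ?case
    using num_leaves_pos[of l] num_leaves_pos[of r] by auto
qed simp

lemma distinct_tree_perm: "distinct (tree_perm s T)"
proof (induction T arbitrary: s)
  case (Node l r)
  then show ?case
    using num_leaves_pos[of l] num_leaves_pos[of r] by (auto simp: set_tree_perm)
qed simp

lemma tree_perm_inject: "tree_perm s T = tree_perm s T' \<Longrightarrow> T = T'"
proof (induction T arbitrary: s T')
  case Leaf
  then show ?case by (cases T') auto
next
  case (Node l r)
  then obtain l' r' where T': "T' = Node l' r'"
    by (cases T') auto
  define m where "m = s + num_leaves l + num_leaves r - 2"
  have pos: "num_leaves l > 0" "num_leaves r > 0" "num_leaves l' > 0" "num_leaves r' > 0"
    by (simp_all add: num_leaves_pos)
  \<comment> \<open>Equal lengths give equal leaf counts, hence the same maximum \<open>m\<close>;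
    as \<open>m\<close> occurs once, it splits the list in only one way.\<close>
  have "num_leaves (Node l r) - 1 = num_leaves T' - 1"
    using Node.prems by (metis length_tree_perm)
  then have m': "m = s + num_leaves l' + num_leaves r' - 2"
    using pos T' by (simp add: m_def)
  have "m \<notin> set (tree_perm s l)" "m \<notin> set (tree_perm s l')"
    using pos m' by (auto simp: set_tree_perm m_def)
  moreover have "tree_perm s l @ m # tree_perm (s + num_leaves l - 1) r =
      tree_perm s l' @ m # tree_perm (s + num_leaves l' - 1) r'"
    using Node.prems T' m' by (simp add: m_def)
  moreover have "m \<notin> set (tree_perm (s + num_leaves l - 1) r)"
    using pos by (auto simp: set_tree_perm m_def)
  ultimately have eq: "tree_perm s l = tree_perm s l'"
    "tree_perm (s + num_leaves l - 1) r = tree_perm (s + num_leaves l' - 1) r'"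
    by (auto simp: append_Cons_eq_iff)
  then have "l = l'"
    using Node.IH(1) by blast
  then show ?case
    using eq(2) Node.IH(2) T' by blast
qed

section \<open>Patterns in a list of the form \<open>L @ m # R\<close>\<close>

lemma subseq_set: "subseq xs ys \<Longrightarrow> set xs \<subseteq> set ys"
  by (metis notin_set_nthsI subseq_conv_nths subsetI)

lemma subseq_Cons_iff:
  "subseq xs (y # ys) \<longleftrightarrow> subseq xs ys \<or> (\<exists>xs'. xs = y # xs' \<and> subseq xs' ys)"
  by (auto elim: list_emb.cases)

lemma not_contains_231_append:
  assumes "\<not> contains_231 L" "\<not> contains_231 R"
    and "\<forall>x\<in>set L. \<forall>y\<in>set R. x < y" "\<forall>x\<in>set L. x < m" "\<forall>y\<in>set R. y < m"
  shows "\<not> contains_231 (L @ m # R)"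
proof
  assume "contains_231 (L @ m # R)"
  then obtain x y z p q where xyz: "z < x" "x < y" and pq: "[x, y, z] = p @ q"
    and p: "subseq p L" and q: "subseq q (m # R)"
    unfolding contains_231_def subseq_append_iff by blast
  have sets: "set p \<subseteq> set L" "set q \<subseteq> insert m (set R)"
    using p q subseq_set by fastforce+
  \<comment> \<open>An occurrence meeting both sides has its first entry in \<open>L\<close> and its
    last in \<open>m # R\<close>, contradicting \<open>z < x\<close>.\<close>
  consider "p = []" "q = [x, y, z]" | "x \<in> set p" "z \<in> set q" | "p = [x, y, z]"
    using pq by (auto simp: Cons_eq_append_conv)
  then show False
  proof cases
    case 1
    then have "subseq [x, y, z] R \<or> (x = m \<and> subseq [y, z] R)"
      using q by (auto simp: subseq_Cons_iff)
    then show False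
    proof
      assume "subseq [x, y, z] R"
      then show False
        using assms(2) xyz unfolding contains_231_def by blast
    next
      assume "x = m \<and> subseq [y, z] R"
      then have "x = m" "y \<in> set R"
        using subseq_set[of "[y, z]" R] by simp_all
      then show False
        using assms(5) xyz(2) by fastforce
    qed
  next
    case 2
    then show False
      using sets assms(3,4) xyz by fastforce
  next
    case 3
    then show False
      using p assms(1) xyz unfolding contains_231_def by blast
  qed
qed

lemma tree_perm_Node_order:
  shows "\<forall>x\<in>set (tree_perm s l). \<forall>y\<in>set (tree_perm (s + num_leaves l - 1) r). x < y"
    and "\<forall>x\<in>set (tree_perm s l). x < s + num_leaves l + num_leaves r - 2"
    and "\<forall>y\<in>set (tree_perm (s + num_leaves l - 1) r). y < s + num_leaves l + num_leaves r - 2"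
  using num_leaves_pos[of l] num_leaves_pos[of r] by (auto simp: set_tree_perm)

lemma not_contains_231_tree_perm: "\<not> contains_231 (tree_perm s T)"
proof (induction T arbitrary: s)
  case Leaf
  then show ?case by (simp add: contains_231_def)
next
  case (Node l r)
  then show ?case
    using not_contains_231_append tree_perm_Node_order by simp
qed

lemma has_decreasing_antimono: "has_decreasing (Suc m) xs \<Longrightarrow> has_decreasing m xs"
  unfolding has_decreasing_def
  by (metis length_Suc_conv sorted_wrt.simps(2) subseq_Cons')

text \<open>Entries of \<open>L\<close> lie below everything after them, so a decreasing subsequence
  stays on one side; on the right, \<open>m\<close> can be put in front of any decreasing
  subsequence of \<open>R\<close>.\<close>

lemma has_decreasing_append:
  assumes "\<forall>x\<in>set L. \<forall>y\<in>set R. x < y" "\<forall>x\<in>set L. x < m" "\<forall>y\<in>set R. y < m"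
  shows "has_decreasing (Suc k) (L @ m # R) \<longleftrightarrow> has_decreasing (Suc k) L \<or> has_decreasing k R"
proof
  assume "has_decreasing (Suc k) (L @ m # R)"
  then obtain p q where p: "subseq p L" and q: "subseq q (m # R)"
    and len: "length (p @ q) = Suc k" and sorted: "sorted_wrt (>) (p @ q)"
    unfolding has_decreasing_def subseq_append_iff by blast
  have sets: "set p \<subseteq> set L" "set q \<subseteq> insert m (set R)"
    using p q subseq_set by fastforce+
  have "p = [] \<or> q = []"
  proof (rule ccontr)
    assume "\<not> ?thesis"
    then obtain x y where "x \<in> set p" "y \<in> set q"
      by (meson list.set_sel(1))
    then have "x < y" "y < x"
      using sets assms(1,2) sorted by (fastforce simp: sorted_wrt_append)+
    then show False by simp
  qed
  then show "has_decreasing (Suc k) L \<or> has_decreasing k R"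
  proof
    assume "q = []"
    then show ?thesis
      using p len sorted unfolding has_decreasing_def by auto
  next
    assume "p = []"
    \<comment> \<open>The subsequence either skips \<open>m\<close> or starts with it; in the first
      case it is shortened.\<close>
    then have "has_decreasing (Suc k) R \<or> has_decreasing k R"
      using q len sorted unfolding has_decreasing_def subseq_Cons_iff by auto
    then show ?thesis
      using has_decreasing_antimono by blast
  qed
next
  assume "has_decreasing (Suc k) L \<or> has_decreasing k R"
  then show "has_decreasing (Suc k) (L @ m # R)"
  proof
    assume "has_decreasing (Suc k) L"
    then show ?thesis
      unfolding has_decreasing_def by (meson list_emb_append2 subseq_rev_drop_many)
  next
    assume "has_decreasing k R"
    then obtain ys where ys: "subseq ys R" "length ys = k" "sorted_wrt (>) ys"
      unfolding has_decreasing_def by blast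
    then have "subseq (m # ys) (L @ m # R)" "sorted_wrt (>) (m # ys)"
      using assms(3) subseq_set by (auto intro: list_emb_append2)
    with ys(2) show ?thesis
      unfolding has_decreasing_def by (intro exI[of _ "m # ys"]) simp
  qed
qed

lemma has_decreasing_0 [simp]: "has_decreasing 0 xs"
  by (simp add: has_decreasing_def)

lemma has_decreasing_tree_perm: "has_decreasing k (tree_perm s T) \<longleftrightarrow> emb T (right_comb k)"
proof (induction T arbitrary: s k)
  case Leaf
  then show ?case
    by (cases k) (auto simp: has_decreasing_def)
next
  case (Node l r)
  show ?case
  proof (cases k)
    case (Suc j)
    have "has_decreasing k (tree_perm s (Node l r)) \<longleftrightarrow>
        emb l (right_comb (Suc j)) \<or> emb r (right_comb j)"
      using has_decreasing_append[OF tree_perm_Node_order] Node.IH Suc by simp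
    \<comment> \<open>The comb at the root needs only a leaf on the left and the shorter comb in
      \<open>r\<close>; this covers the case of the full comb inside \<open>r\<close>.\<close>
    also have "\<dots> \<longleftrightarrow> emb (Node l r) (right_comb k)"
      using emb_Node_pattern[of r Leaf "right_comb j"] Suc by auto
    finally show ?thesis .
  qed simp
qed

section \<open>Surjectivity: rebuilding the tree from the permutation\<close>

lemma interval_split:
  fixes A B :: "nat set"
  assumes "A \<union> B = {s..<e}" "\<forall>x\<in>A. \<forall>y\<in>B. x < y"
  obtains c where "s \<le> c" "c \<le> max s e" "A = {s..<c}" "B = {c..<e}"
proof (cases "B = {}")
  case True
  then show ?thesis
    \<comment> \<open>With \<open>B\<close> empty the cut is at the end; \<open>max\<close> keeps it
      at least \<open>s\<close> when the interval is empty.\<close>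
    using that[of "max s e"] assms by (auto simp: max_def)
next
  case False
  have fin: "finite A" "finite B"
    using assms(1) by (metis finite_Un finite_atLeastLessThan)+
  define c where "c = Min B"
  have c: "c \<in> B" "\<And>y. y \<in> B \<Longrightarrow> c \<le> y"
    using fin False by (auto simp: c_def)
  have iff: "x \<in> A \<or> x \<in> B \<longleftrightarrow> s \<le> x \<and> x < e" for x
    using assms(1) by (metis Un_iff atLeastLessThan_iff)
  have A: "x \<in> A \<longleftrightarrow> s \<le> x \<and> x < c" for x
    using iff[of x] iff[of c] c assms(2) by (metis less_trans not_le)
  have B: "x \<in> B \<longleftrightarrow> c \<le> x \<and> x < e" for x
    using iff[of x] iff[of c] c assms(2) A by (metis le_trans not_le)
  have "A = {s..<c}" "B = {c..<e}"
    using A B by (simp_all add: set_eq_iff)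
  moreover have "s \<le> c" "c \<le> max s e"
    using iff[of c] c(1) by simp_all
  ultimately show ?thesis
    using that by blast
qed

text \<open>Splitting at the maximum gives two shorter lists, each filling an interval, so induction
  applies with offsets \<open>s\<close> and \<open>c\<close>.\<close>

lemma tree_perm_surj:
  assumes "distinct xs" "set xs = {s..<s + length xs}" "\<not> contains_231 xs"
  shows "\<exists>T. tree_perm s T = xs"
  using assms
proof (induction xs arbitrary: s rule: measure_induct_rule[of length])
  case (less xs)
  show ?case
  proof (cases "xs = []")
    case True
    then have "tree_perm s Leaf = xs" by simp
    then show ?thesis by blast
  next
    case False
    define m where "m = s + length xs - 1"
    have "m \<in> set xs"
      using False less.prems(2) by (cases xs) (auto simp: m_def)
    then obtain L R where xs: "xs = L @ m # R"
      by (meson split_list)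
    have "x < y" if "x \<in> set L" "y \<in> set R" for x y
    proof -
      \<comment> \<open>With the maximum between them, \<open>y < x\<close> would create a
        231.\<close>
      have "subseq [x, m, y] xs"
        unfolding xs using that list_emb_append_mono[of "(=)" "[x]" L "[m, y]" "m # R"]
        by (simp add: subseq_singleton_left)
      moreover have "x < m"
      proof -
        have "x \<in> set xs" "x \<noteq> m"
          using that less.prems(1) by (auto simp: xs)
        then show ?thesis
          unfolding less.prems(2) by (auto simp: m_def)
      qed
      ultimately have "\<not> y < x"
        using less.prems(3) unfolding contains_231_def by blast
      moreover have "x \<noteq> y"
        using that less.prems(1) by (auto simp: xs)
      ultimately show ?thesis by simp
    qed
    moreover have "set L \<union> set R = {s..<m}"
    proof -
      have "set L \<union> set R = set xs - {m}"
        using less.prems(1) by (auto simp: xs)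
      also have "\<dots> = {s..<m}"
        unfolding less.prems(2) using False by (auto simp: m_def)
      finally show ?thesis .
    qed
    ultimately obtain c where c: "s \<le> c" "c \<le> max s m" "set L = {s..<c}" "set R = {c..<m}"
      using interval_split[of "set L" "set R" s m] by blast
    have dist: "distinct L" "distinct R"
      using less.prems(1) by (auto simp: xs)
    have "s \<le> m"
      unfolding m_def using False by (cases xs) simp_all
    with c have len: "c = s + length L" "m = c + length R"
      using dist distinct_card[of L] distinct_card[of R] by auto
    have "\<not> contains_231 L" "\<not> contains_231 R"
      using less.prems(3) unfolding contains_231_def xs
      by (meson list_emb_append2 subseq_rev_drop_many list_emb_Cons)+
    then obtain l r where lr: "tree_perm s l = L" "tree_perm c r = R"
      using less.IH[of L s] less.IH[of R c] dist c(3,4) len by (auto simp: xs)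
    then have "num_leaves l = Suc (length L)" "num_leaves r = Suc (length R)"
      using length_tree_perm num_leaves_pos by (metis Suc_diff_1)+
    then have "tree_perm s (Node l r) = xs"
      using lr len by (simp add: xs)
    then show ?thesis by blast
  qed
qed

text \<open>The offset 1 makes the entries of a tree with \<open>n\<close> leaves exactly
  \<open>{1..n - 1}\<close>.\<close>

lemma bij_betw_tree_perm:
  assumes "n \<ge> 1"
  shows "bij_betw (tree_perm 1) (avoiding (right_comb m) n)
    {\<pi> \<in> permutations_of_set {1..n - 1}. \<not> contains_231 \<pi> \<and> \<not> has_decreasing m \<pi>}"
proof (rule bij_betw_imageI)
  show "inj_on (tree_perm 1) (avoiding (right_comb m) n)"
    using tree_perm_inject by (auto simp: inj_on_def)
  show "tree_perm 1 ` avoiding (right_comb m) n =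
    {\<pi> \<in> permutations_of_set {1..n - 1}. \<not> contains_231 \<pi> \<and> \<not> has_decreasing m \<pi>}"
  proof (intro equalityI subsetI)
    fix \<pi> assume "\<pi> \<in> tree_perm 1 ` avoiding (right_comb m) n"
    then show "\<pi> \<in> {\<pi> \<in> permutations_of_set {1..n - 1}. \<not> contains_231 \<pi> \<and> \<not> has_decreasing m \<pi>}"
      using assms by (auto simp: permutations_of_set_def avoiding_def set_tree_perm
          distinct_tree_perm not_contains_231_tree_perm has_decreasing_tree_perm)
  next
    fix \<pi> assume \<pi>: "\<pi> \<in> {\<pi> \<in> permutations_of_set {1..n - 1}. \<not> contains_231 \<pi> \<and> \<not> has_decreasing m \<pi>}"
    then have *: "distinct \<pi>" "set \<pi> = {1..n - 1}"
      by (auto simp: permutations_of_set_def)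
    then have len: "length \<pi> = n - 1"
      using distinct_card by fastforce
    then obtain T where T: "tree_perm 1 T = \<pi>"
      using tree_perm_surj[of \<pi> 1] * \<pi> by fastforce
    then have "num_leaves T = n"
      using len length_tree_perm[of 1 T] num_leaves_pos[of T] assms by simp
    then show "\<pi> \<in> tree_perm 1 ` avoiding (right_comb m) n"
      using T \<pi> has_decreasing_tree_perm by (auto simp: avoiding_def)
  qed
qed

theorem theorem6:
  fixes t :: btree and k n :: nat
  assumes "num_leaves t = k" and "k \<ge> 2" and "n \<ge> 1"
  shows "av t n = num_avoiding_perms {[2, 3, 1], rev [1..<k]} (n - 1)"
proof -
  \<comment> \<open>The comb has \<open>k - 1\<close> internal vertices, matching the length of the
    decreasing pattern.\<close>
  have "av t n = card (avoiding (right_comb (k - 1)) n)"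
    using av_eq_right_comb assms(1) av_eq_card_avoiding by metis
  also have "\<dots> = card {\<pi> \<in> permutations_of_set {1..n - 1}.
      \<not> contains_231 \<pi> \<and> \<not> has_decreasing (k - 1) \<pi>}"
    using bij_betw_tree_perm[OF assms(3)] by (rule bij_betw_same_card)
  also have "\<dots> = num_avoiding_perms {[2, 3, 1], rev [1..<k]} (n - 1)"
    by (simp only: num_avoiding_perms_def ball_simps perm_contains_231_iff
        perm_contains_decreasing_iff) simp
  finally show ?thesis .
qed

end
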